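(* Let $\ell_a,\ell_b$ be non-negative integers and let $w,u,v \in W(\ell_a,\ell_b)$. (i) If $w \preceq u \preceq v$ and $w\sim_2 v$, then $w\sim_2 u$. (ii) If $w\sim_2 v$, then $w \sim_2 w\vee v \sim_2 w\wedge v$.
   Context: Let $\mathbb{T}=(\mathbb{R}\cup\{-\infty\},\oplus,\odot)$ be the tropical semifield, $x\oplus y=\max(x,y)$, $x\odot y=x+y$. $\mathcal{UT}_n(\mathbb{T})$ is the semigroup, under tropical matrix multiplication, of all $n\times n$ matrices $M$ over $\mathbb{T}$ with $M_{ij}=-\infty$ whenever $i>j$. For words $w,v\in\Sigma^+$ (the free semigroup on a finite alphabet $\Sigma$), $w\sim_n v$ means that $\varphi(w)=\varphi(v)$ for every semigroup morphism $\varphi:\Sigma^+\to\mathcal{UT}_n(\mathbb{T})$. $W(\ell_a,\ell_b)$ is the set of words over $\{a,b\}$ with exactly $\ell_a$ occurrences of $a$ and $\ell_b$ occurrences of $b$. The path of $w\in W(\ell_a,\ell_b)$ is the Northeast staircase path from $(0,0)$ to $(\ell_a,\ell_b)$ obtained by reading $w$ from left to right, moving by $(1,0)$ for each $a$ and by $(0,1)$ for each $b$. Define $w\preceq v$ if the path of $w$ does not rise above the path of $v$; equivalently, for each $0\le i\le \ell_a-1$, the number of $b$'s preceding the $(i+1)$th $a$ in $w$ is at most the number of $b$'s preceding the $(i+1)$th $a$ in $v$. With this order $W(\ell_a,\ell_b)$ is a distributive lattice, with meet $\wedge$ and join $\vee$. *)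

theory Defs
  imports
    "HOL-Library.Extended_Real"
    "HOL-Algebra.Lattice"
    "Jordan_Normal_Form.Matrix"
begin

text \<open>
  The tropical semifield \<open>\<real> \<union> {-\<infinity>}\<close>. In the semiring instance below, addition is the maximum,
  multiplication is the usual addition, \<open>0\<close> is \<open>-\<infinity>\<close> and \<open>1\<close> is the real number \<open>0\<close>. In this way
  the library's matrix product is the tropical one, and \<^const>\<open>upper_triangular\<close> says that the
  entries below the diagonal are \<open>-\<infinity>\<close>.
\<close>

typedef tropical = "{x :: ereal. x \<noteq> \<infinity>}"
  by (rule exI[of _ 0]) simp

setup_lifting type_definition_tropical

instantiation tropical :: comm_semiring_1
begin

lift_definition zero_tropical :: tropical is "- \<infinity>" by simp
lift_definition one_tropical :: tropical is "0 :: ereal" by simp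
lift_definition plus_tropical :: "tropical \<Rightarrow> tropical \<Rightarrow> tropical" is max
  by (simp add: max_def)
lift_definition times_tropical :: "tropical \<Rightarrow> tropical \<Rightarrow> tropical" is "(+)"
  by simp

instance
proof
  fix a b c :: tropical
  show "a + b + c = a + (b + c)" by transfer (simp add: max.assoc)
  show "a + b = b + a" by transfer (simp add: max.commute)
  show "0 + a = a" by transfer simp
  show "a * b * c = a * (b * c)" by transfer (simp add: add.assoc)
  show "a * b = b * a" by transfer (simp add: add.commute)
  show "1 * a = a" by transfer simp
  show "0 * a = 0" by transfer simp
  show "a * 0 = 0" by transfer simp
  show "(a + b) * c = a * c + b * c"
  proof transfer
    fix a b c :: ereal
    show "max a b + c = max (a + c) (b + c)"
      by (cases a b rule: le_cases) (simp_all add: max_absorb1 max_absorb2 add_right_mono)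
  qed
  show "(0 :: tropical) \<noteq> 1" by transfer simp
qed

end

definition UT :: "nat \<Rightarrow> tropical mat set" where
  "UT n = {M \<in> carrier_mat n n. upper_triangular M}"

text \<open>
  Semigroup morphisms from \<open>\<Sigma>\<^sup>+\<close>, with \<open>\<Sigma>\<close> the type \<open>'a\<close>, to \<^term>\<open>UT n\<close>. Elements of the free
  semigroup are the nonempty lists; the value at the empty list is unconstrained.
\<close>

definition UT_morphism :: "nat \<Rightarrow> ('a list \<Rightarrow> tropical mat) \<Rightarrow> bool" where
  "UT_morphism n \<phi> \<longleftrightarrow>
     (\<forall>w. w \<noteq> [] \<longrightarrow> \<phi> w \<in> UT n) \<and>
     (\<forall>w v. w \<noteq> [] \<longrightarrow> v \<noteq> [] \<longrightarrow> \<phi> (w @ v) = \<phi> w * \<phi> v)"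

text \<open>
  On nonempty words this is the relation \<open>\<sim>\<^sub>n\<close>. The empty word, which is not in \<open>\<Sigma>\<^sup>+\<close>, is related
  to itself only.
\<close>

definition UT_equiv :: "'a list \<Rightarrow> nat \<Rightarrow> 'a list \<Rightarrow> bool"
    (\<open>(_ \<sim>\<^bsub>_\<^esub> _)\<close> [51, 0, 51] 50) where
  "w \<sim>\<^bsub>n\<^esub> v \<longleftrightarrow> (\<forall>\<phi>. UT_morphism n \<phi> \<longrightarrow> \<phi> w = \<phi> v)"

datatype letter = A | B

definition W :: "nat \<Rightarrow> nat \<Rightarrow> letter list set" where
  "W la lb = {w. count_list w A = la \<and> count_list w B = lb}"

text \<open>
  For \<open>i < count_list w A\<close>, the number of \<open>B\<close>s preceding the \<open>(i + 1)\<close>th \<open>A\<close> in \<open>w\<close>, that is, the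
  height of the path of \<open>w\<close> over the interval from \<open>i\<close> to \<open>i + 1\<close>; irrelevant for other \<open>i\<close>.
\<close>

fun bs_before :: "nat \<Rightarrow> letter list \<Rightarrow> nat" where
  "bs_before i [] = 0"
| "bs_before i (B # w) = Suc (bs_before i w)"
| "bs_before 0 (A # w) = 0"
| "bs_before (Suc i) (A # w) = bs_before i w"

lemma bs_before_append_A:
  "bs_before (count_list xs A) (xs @ A # ys) = count_list xs B"
proof (induction xs)
  case (Cons x xs)
  then show ?case by (cases x) simp_all
qed simp

definition path_le :: "letter list \<Rightarrow> letter list \<Rightarrow> bool" (infix \<open>\<preceq>\<close> 50) where
  "w \<preceq> v \<longleftrightarrow> (\<forall>i < count_list w A. bs_before i w \<le> bs_before i v)"

definition word_order :: "nat \<Rightarrow> nat \<Rightarrow> letter list gorder" where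
  "word_order la lb = \<lparr>carrier = W la lb, eq = (=), le = (\<preceq>)\<rparr>"

lemma bs_before_le: "bs_before i w \<le> count_list w B"
  by (induction i w rule: bs_before.induct) auto

lemma bs_before_mono: "i \<le> j \<Longrightarrow> j < count_list w A \<Longrightarrow> bs_before i w \<le> bs_before j w"
proof (induction i w arbitrary: j rule: bs_before.induct)
  case (4 i w)
  then show ?case by (cases j) auto
qed auto

lemma bs_before_inject:
  assumes "w \<in> W la lb" "v \<in> W la lb" "\<And>i. i < la \<Longrightarrow> bs_before i w = bs_before i v"
  shows "w = v"
  using assms
proof (induction w arbitrary: v la lb)
  case Nil
  then have "count_list v A = 0" "count_list v B = 0" by (auto simp: W_def)
  then have "x \<notin> set v" for x by (cases x) (auto simp: count_list_0_iff)
  then show ?case by (metis ex_in_conv set_empty)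
next
  case (Cons x w)
  show ?case
  proof (cases v)
    case Nil
    then show ?thesis using Cons.prems by (cases x) (auto simp: W_def)
  next
    case v: (Cons y v')
    show ?thesis
    proof (cases x)
      case x: A
      then have "la > 0" using Cons.prems(1) by (auto simp: W_def)
      then have y: "y = A" using Cons.prems(3)[of 0] v x by (cases y) auto
      have "w = v'"
      proof (rule Cons.IH)
        show "w \<in> W (la - 1) lb" "v' \<in> W (la - 1) lb"
          using Cons.prems(1,2) v x y by (auto simp: W_def)
        show "bs_before i w = bs_before i v'" if "i < la - 1" for i
          using Cons.prems(3)[of "Suc i"] that v x y by auto
      qed
      then show ?thesis using v x y by simp
    next
      case x: B
      have y: "y = B"
      proof (cases y)
        case A
        then have "la > 0" using Cons.prems(2) v by (auto simp: W_def)
        then show ?thesis using Cons.prems(3)[of 0] v x A by auto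
      qed
      have "w = v'"
      proof (rule Cons.IH)
        show "w \<in> W la (lb - 1)" "v' \<in> W la (lb - 1)"
          using Cons.prems(1,2) v x y by (auto simp: W_def)
        show "bs_before i w = bs_before i v'" if "i < la" for i
          using Cons.prems(3)[of i] that v x y by auto
      qed
      then show ?thesis using v x y by simp
    qed
  qed
qed

lemma exists_word_bs_before:
  assumes "\<And>i j. i \<le> j \<Longrightarrow> j < la \<Longrightarrow> h i \<le> h j" "\<And>i. i < la \<Longrightarrow> h i \<le> lb"
  shows "\<exists>w \<in> W la lb. \<forall>i < la. bs_before i w = h i"
  using assms
proof (induction la arbitrary: h lb)
  case 0
  have "count_list (replicate lb B) A = 0" "count_list (replicate lb B) B = lb"
    by (induction lb) auto
  then have "replicate lb B \<in> W 0 lb" by (simp add: W_def)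
  then show ?case by auto
next
  case (Suc la)
  define c where "c = h 0"
  have c: "c \<le> h i" if "i < Suc la" for i
    using Suc.prems(1)[of 0 i] that by (simp add: c_def)
  have "\<exists>w \<in> W la (lb - c). \<forall>i < la. bs_before i w = h (Suc i) - c"
  proof (rule Suc.IH)
    show "h (Suc i) - c \<le> h (Suc j) - c" if "i \<le> j" "j < la" for i j
      using Suc.prems(1)[of "Suc i" "Suc j"] that by simp
    show "h (Suc i) - c \<le> lb - c" if "i < la" for i
      using Suc.prems(2)[of "Suc i"] that by simp
  qed
  then obtain w where w: "w \<in> W la (lb - c)" "\<And>i. i < la \<Longrightarrow> bs_before i w = h (Suc i) - c"
    by auto
  have rep: "bs_before i (replicate k B @ u) = k + bs_before i u"
    "count_list (replicate k B) A = 0" "count_list (replicate k B) B = k" for i k u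
    by (induction k) auto
  have "c \<le> lb" using Suc.prems(2)[of 0] by (simp add: c_def)
  then have "replicate c B @ A # w \<in> W (Suc la) lb"
    using w(1) by (simp add: W_def rep)
  moreover have "bs_before i (replicate c B @ A # w) = h i" if "i < Suc la" for i
    using that w(2) c[OF that] by (cases i) (auto simp: rep c_def)
  ultimately show ?case by blast
qed

text \<open>
  In \<open>HOL-Algebra\<close> the join and meet are choice expressions, which are meaningful because the
  words form a lattice.
\<close>

lemma lattice_word_order: "lattice (word_order la lb)"
proof -
  let ?L = "word_order la lb"
  have car: "carrier ?L = W la lb" by (simp add: word_order_def)
  have le: "le ?L w v \<longleftrightarrow> (\<forall>i < la. bs_before i w \<le> bs_before i v)" if "w \<in> W la lb" for w v
    using that by (auto simp: word_order_def path_le_def W_def)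
  have eq: "eq ?L = (=)" by (simp add: word_order_def)
  interpret partial_order ?L
  proof
    fix x y z
    assume *: "x \<sqsubseteq>\<^bsub>?L\<^esub> y" "y \<sqsubseteq>\<^bsub>?L\<^esub> z" "x \<in> carrier ?L" "y \<in> carrier ?L" "z \<in> carrier ?L"
    show "x \<sqsubseteq>\<^bsub>?L\<^esub> z"
      using * by (auto simp: car le intro: le_trans)
  next
    fix x y
    assume *: "x \<sqsubseteq>\<^bsub>?L\<^esub> y" "y \<sqsubseteq>\<^bsub>?L\<^esub> x" "x \<in> carrier ?L" "y \<in> carrier ?L"
    show "x .=\<^bsub>?L\<^esub> y"
      unfolding eq using * by (intro bs_before_inject[of _ la lb]) (auto simp: car le intro: antisym)
  qed (auto simp: eq car le)
  have bounds: "bs_before i w \<le> lb" if "w \<in> W la lb" for i w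
    using bs_before_le[of i w] that by (simp add: W_def)
  have mono: "bs_before i w \<le> bs_before j w" if "w \<in> W la lb" "i \<le> j" "j < la" for i j w
    using bs_before_mono[of i j w] that by (simp add: W_def)
  show ?thesis
  proof
    fix x y
    assume xy: "x \<in> carrier ?L" "y \<in> carrier ?L"
    obtain s where s: "s \<in> W la lb" "\<And>i. i < la \<Longrightarrow> bs_before i s = max (bs_before i x) (bs_before i y)"
      using exists_word_bs_before[of la "\<lambda>i. max (bs_before i x) (bs_before i y)" lb] xy
      by (fastforce simp: car bounds mono intro: max.mono)
    have "least ?L s (Upper ?L {x, y})"
      using xy s by (auto simp: least_def Upper_def car le)
    then show "\<exists>s. least ?L s (Upper ?L {x, y})" ..
    obtain t where t: "t \<in> W la lb" "\<And>i. i < la \<Longrightarrow> bs_before i t = min (bs_before i x) (bs_before i y)"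
      using exists_word_bs_before[of la "\<lambda>i. min (bs_before i x) (bs_before i y)" lb] xy
      by (fastforce simp: car bounds mono min_le_iff_disj intro: min.mono)
    have "greatest ?L t (Lower ?L {x, y})"
      using xy t by (auto simp: greatest_def Lower_def car le)
    then show "\<exists>s. greatest ?L s (Lower ?L {x, y})" ..
  qed
qed

end

theory Submission
  imports Defs
begin

text \<open>
  Both parts follow from one principle (\<open>UT_equiv_between\<close>): if \<open>w \<sim>\<^bsub>2\<^esub> v\<close> and the path of \<open>u\<close> has, over
  each unit interval, a height between those of \<open>w\<close> and \<open>v\<close>, then \<open>w \<sim>\<^bsub>2\<^esub> u\<close>. An element of the
  interval from \<open>w\<close> to \<open>v\<close>, the join and the meet are all of this kind.

  For an upper triangular \<open>2 \<times> 2\<close> representation the diagonal entries of the image of a word depend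
  only on the letter counts. The corner entry splits as \<open>y A * S\<^sub>A + y B * S\<^sub>B\<close>, where \<open>y\<close> holds the
  corners of the images of the letters and \<open>S\<^sub>A\<close>, \<open>S\<^sub>B\<close> depend only on their diagonals \<open>x\<close>, \<open>z\<close>; as \<open>y\<close>
  is free, \<open>w \<sim>\<^bsub>2\<^esub> v\<close> says that \<open>S\<^sub>A\<close> and \<open>S\<^sub>B\<close> agree on \<open>w\<close> and \<open>v\<close>. With
  \<open>h\<^sub>i\<close> the number of \<open>B\<close>s before the \<open>(i + 1)\<close>th \<open>A\<close>, the value \<open>S\<^sub>A\<close> is the maximum over \<open>i\<close> of
  the monomials \<open>x A ^ i * z A ^ (la - 1 - i) * (x B ^ h * z B ^ (lb - h))\<close> with \<open>h = h\<^sub>i\<close>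
  (\<open>corner_A\<close>).

  Scaling \<open>x A\<close> by \<open>d\<close> multiplies the \<open>i\<close>th monomial by \<open>d\<^sup>i\<close>, so \<open>w \<sim>\<^bsub>2\<^esub> v\<close> gives two tropical
  polynomials in \<open>d\<close> that agree as functions. Such polynomials attain their maximum at \<open>d = 1\<close> in a
  common index, because a value of \<open>d\<close> slightly below \<open>1\<close> detects the smallest maximizing index
  (\<open>common_maximizer\<close>). As a function of \<open>h\<close> the monomial is monotone or antitone, according to the
  order of \<open>x B\<close> and \<open>z B\<close>. So each monomial of \<open>u\<close> lies between those of \<open>w\<close> and \<open>v\<close>: it is at most the
  common maximum, and at the common index it equals it. This proves that \<open>S\<^sub>A\<close> agrees on \<open>u\<close>
  (\<open>corner_A_between\<close>). Geometrically, the points \<open>(i, h\<^sub>i)\<close> of \<open>w\<close> and of \<open>v\<close> have the same convex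
  hull; its vertices are points of both words, hence also of \<open>u\<close>.

  Exchanging the letters reduces \<open>S\<^sub>B\<close> to \<open>S\<^sub>A\<close>; being between two paths is preserved by this
  reflection (\<open>between_swap\<close>).
\<close>

section \<open>The order of the tropical semifield\<close>

instantiation tropical :: linorder
begin

lift_definition less_eq_tropical :: "tropical \<Rightarrow> tropical \<Rightarrow> bool" is "(\<le>)" .
lift_definition less_tropical :: "tropical \<Rightarrow> tropical \<Rightarrow> bool" is "(<)" .

instance
  by standard (transfer; force)+

end

lemma tropical_add_eq_max: "a + b = max a b" for a b :: tropical
  unfolding max_def by transfer (simp add: max_def)

instance tropical :: canonically_ordered_monoid_add
proof
  fix a b :: tropical
  show "a \<le> b \<longleftrightarrow> (\<exists>c. b = a + c)"
    by (metis max.absorb2 max.cobounded1 tropical_add_eq_max)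
qed

instance tropical :: ordered_comm_semiring
  by standard (transfer; simp add: add_left_mono)

lemma tropical_sum_le:
  fixes f :: "'i \<Rightarrow> tropical"
  assumes "\<And>i. i \<in> S \<Longrightarrow> f i \<le> c"
  shows "sum f S \<le> c"
  using assms by (induction S rule: infinite_finite_induct) (auto simp: tropical_add_eq_max)

lemma tropical_sum_less:
  fixes f :: "'i \<Rightarrow> tropical"
  assumes "\<And>i. i \<in> S \<Longrightarrow> f i < c" "0 < c"
  shows "sum f S < c"
  using assms by (induction S rule: infinite_finite_induct) (auto simp: tropical_add_eq_max)

lemma tropical_sum_attained:
  fixes f :: "'i \<Rightarrow> tropical"
  assumes "finite S" "S \<noteq> {}"
  shows "\<exists>i \<in> S. f i = sum f S"
  using assms by (induction rule: finite_ne_induct) (auto simp: tropical_add_eq_max max_def)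

lift_definition trop :: "real \<Rightarrow> tropical" is ereal by simp

lemma trop_simps:
  "trop r * trop s = trop (r + s)" "trop r \<le> trop s \<longleftrightarrow> r \<le> s" "trop r < trop s \<longleftrightarrow> r < s"
  "0 < trop r" "1 = trop 0"
  by (transfer; simp)+

lemma trop_power: "trop r ^ k = trop (real k * r)"
  by (induction k) (simp_all add: trop_simps algebra_simps)

lemma tropical_cases: obtains "a = 0" | r where "a = trop r"
proof -
  have "a = 0 \<or> (\<exists>r. a = trop r)"
    by transfer (metis ereal_cases)
  then show ?thesis using that by blast
qed

lemma tropical_power_mono: "a \<le> b \<Longrightarrow> a ^ k \<le> b ^ k" for a b :: tropical
  by (induction k) (simp_all add: mult_mono)

text \<open>
  Strict inequalities against a real value leave room for a real gap that is uniform over a finite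
  set; this is where the size of a perturbation comes from.
\<close>

lemma finite_below_trop:
  assumes "finite S" "\<And>a. a \<in> S \<Longrightarrow> a < trop r"
  shows "\<exists>s < r. \<forall>a \<in> S. a \<le> trop s"
  using assms
proof (induction rule: finite_induct)
  case empty
  then show ?case by (intro exI[of _ "r - 1"]) simp
next
  case (insert a S)
  then obtain s where s: "s < r" "\<forall>a \<in> S. a \<le> trop s" by auto
  show ?case
  proof (cases a rule: tropical_cases)
    case 1
    then show ?thesis using s by auto
  next
    case (2 t)
    then have "t < r" using insert.prems[of a] by (simp add: trop_simps)
    then show ?thesis
      using s 2 by (intro exI[of _ "max s t"]) (auto simp: trop_simps intro: order_trans)
  qed
qed

section \<open>Tropical polynomials that define the same function\<close>

text \<open>
  Suppose that \<open>Q i < m\<close> for all \<open>i \<le> p\<close>. At \<open>d = trop (- e)\<close> with a small \<open>e > 0\<close> the term of \<open>P\<close> at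
  \<open>p\<close> loses only \<open>p * e\<close>, while the terms of \<open>Q\<close> beyond \<open>p\<close> lose at least \<open>(p + 1) * e\<close> and those up to \<open>p\<close>
  are smaller than \<open>m\<close> by more than \<open>p * e\<close>. So \<open>P\<close> exceeds \<open>Q\<close> there.
\<close>

lemma maximum_at_most:
  fixes P Q :: "nat \<Rightarrow> tropical"
  assumes fun_le: "\<And>d. (\<Sum>i<n. d ^ i * P i) \<le> (\<Sum>i<n. d ^ i * Q i)"
    and p: "p < n" "P p = m" and m: "m \<noteq> 0" and Q_le: "\<And>i. i < n \<Longrightarrow> Q i \<le> m"
  shows "\<exists>q \<le> p. Q q = m"
proof (rule ccontr)
  assume "\<not> ?thesis"
  then have Q_less: "Q i < m" if "i \<le> p" for i
    using that Q_le[of i] p(1) by (meson le_neq_trans le_less_trans)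
  obtain r where r: "m = trop r" using m by (cases m rule: tropical_cases) auto
  obtain s where s: "s < r" "\<And>i. i \<le> p \<Longrightarrow> Q i \<le> trop s"
    using finite_below_trop[of "Q ` {..p}" r] Q_less r by auto
  \<comment> \<open>The denominator exceeds \<open>p\<close>, so the loss \<open>p * e\<close> stays strictly below the gap \<open>r - s\<close>.\<close>
  define e where "e = (r - s) / (real p + 1)"
  have e: "e > 0" using s(1) by (simp add: e_def)
  have "real p * e < (real p + 1) * e" using e by simp
  also have "\<dots> = r - s" by (simp add: e_def)
  finally have pe: "real p * e < r - s" .
  let ?c = "trop (r - real p * e)"
  have d: "trop (- e) ^ i = trop (- (real i * e))" for i
    by (simp add: trop_power)
  have "trop (- e) ^ i * Q i < ?c" if i: "i < n" for i
  proof (cases "i \<le> p")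
    case True
    have "trop (- e) ^ i * Q i \<le> 1 * trop s"
      using s(2)[OF True] e by (intro mult_mono) (simp_all add: d trop_simps)
    also have "\<dots> < ?c" using pe by (simp add: trop_simps)
    finally show ?thesis .
  next
    case False
    have "trop (- e) ^ i * Q i \<le> trop (- e) ^ i * trop r"
      using Q_le[OF i] r by (intro mult_left_mono) simp_all
    also have "\<dots> < ?c" using False e by (simp add: d trop_simps)
    finally show ?thesis .
  qed
  then have "(\<Sum>i<n. trop (- e) ^ i * Q i) < ?c"
    by (intro tropical_sum_less) (simp_all add: trop_simps)
  also have "?c = trop (- e) ^ p * P p" using p(2) r by (simp add: d trop_simps)
  also have "\<dots> \<le> (\<Sum>i<n. trop (- e) ^ i * P i)"
    using p(1) by (intro member_le_sum) simp_all
  finally show False using fun_le[of "trop (- e)"] by simp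
qed

text \<open>
  The smallest maximizing indices of \<open>P\<close> and \<open>Q\<close> bound each other by \<open>maximum_at_most\<close>, so they
  coincide. The case of maximum \<open>-\<infinity>\<close> is separate, as all terms are then equal and no perturbation can
  distinguish them.
\<close>

lemma common_maximizer:
  fixes P Q :: "nat \<Rightarrow> tropical"
  assumes fun_eq: "\<And>d. (\<Sum>i<n. d ^ i * P i) = (\<Sum>i<n. d ^ i * Q i)" and n: "n > 0"
  shows "\<exists>i < n. P i = (\<Sum>i<n. P i) \<and> Q i = (\<Sum>i<n. P i)"
proof -
  define m where "m = (\<Sum>i<n. P i)"
  have m_Q: "m = (\<Sum>i<n. Q i)" using fun_eq[of 1] by (simp add: m_def)
  have le: "P i \<le> m" if "i < n" for i
    unfolding m_def using that by (intro member_le_sum) simp_all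
  have le': "Q i \<le> m" if "i < n" for i
    unfolding m_Q using that by (intro member_le_sum) simp_all
  show ?thesis
  proof (cases "m = 0")
    case True
    then have "P 0 = m" "Q 0 = m" using n le le' by (metis le_zero_eq)+
    then show ?thesis using n unfolding m_def[symmetric] by auto
  next
    case False
    have ex: "\<exists>i<n. P i = m" "\<exists>i<n. Q i = m"
      using tropical_sum_attained[of "{..<n}" P] tropical_sum_attained[of "{..<n}" Q] n
      by (auto simp: m_def[symmetric] m_Q[symmetric])
    define p q where "p = (LEAST i. P i = m)" and "q = (LEAST i. Q i = m)"
    have p: "p < n" "P p = m" and q: "q < n" "Q q = m"
      unfolding p_def q_def using ex by (meson LeastI Least_le le_less_trans)+
    have "q \<le> p"
      using maximum_at_most[OF eq_refl[OF fun_eq] p False le'] unfolding q_def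
      by (meson Least_le le_trans)
    moreover have "p \<le> q"
      using maximum_at_most[OF eq_refl[OF fun_eq[symmetric]] q False le] unfolding p_def
      by (meson Least_le le_trans)
    ultimately show ?thesis using p q unfolding m_def[symmetric] by auto
  qed
qed

text \<open>
  The upper bound is termwise, and the lower bound comes from a common maximizer, where \<open>R i\<close> is
  squeezed between two equal values.
\<close>

lemma sum_between:
  fixes P Q R :: "nat \<Rightarrow> tropical"
  assumes fun_eq: "\<And>d. (\<Sum>i<n. d ^ i * P i) = (\<Sum>i<n. d ^ i * Q i)"
    and between: "\<And>i. i < n \<Longrightarrow> min (P i) (Q i) \<le> R i \<and> R i \<le> max (P i) (Q i)"
  shows "(\<Sum>i<n. R i) = (\<Sum>i<n. P i)"
proof (cases "n = 0")
  case False
  have "(\<Sum>i<n. R i) \<le> (\<Sum>i<n. P i)"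
  proof (rule tropical_sum_le)
    fix i assume "i \<in> {..<n}"
    then have "P i \<le> (\<Sum>i<n. P i)" "Q i \<le> (\<Sum>i<n. Q i)" by (auto intro: member_le_sum)
    then show "R i \<le> (\<Sum>i<n. P i)"
      using between[of i] \<open>i \<in> _\<close> fun_eq[of 1] by (auto simp: max_def split: if_splits)
  qed
  moreover have "(\<Sum>i<n. P i) \<le> (\<Sum>i<n. R i)"
  proof -
    obtain i where i: "i < n" "P i = (\<Sum>i<n. P i)" "Q i = (\<Sum>i<n. P i)"
      using common_maximizer[OF fun_eq] False by auto
    have "(\<Sum>i<n. P i) \<le> R i" using between[OF i(1)] i(2,3) by simp
    also have "\<dots> \<le> (\<Sum>i<n. R i)" using i(1) by (intro member_le_sum) simp_all
    finally show ?thesis .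
  qed
  ultimately show ?thesis by simp
qed simp

lemma monomial_antimono:
  fixes x z :: tropical
  assumes "x \<le> z" "h \<le> k" "k \<le> l"
  shows "x ^ k * z ^ (l - k) \<le> x ^ h * z ^ (l - h)"
proof -
  have "x ^ k * z ^ (l - k) = x ^ h * (x ^ (k - h) * z ^ (l - k))"
    using assms(2) by (simp add: power_add[symmetric] mult.assoc[symmetric])
  also have "\<dots> \<le> x ^ h * (z ^ (k - h) * z ^ (l - k))"
    using assms(1) by (intro mult_left_mono mult_right_mono tropical_power_mono) simp_all
  also have "\<dots> = x ^ h * z ^ (l - h)"
    using assms(2,3) by (simp add: power_add[symmetric])
  finally show ?thesis .
qed

lemma monomial_mono:
  fixes x z :: tropical
  assumes "z \<le> x" "h \<le> k" "k \<le> l"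
  shows "x ^ h * z ^ (l - h) \<le> x ^ k * z ^ (l - k)"
  using monomial_antimono[of z x "l - k" "l - h" l] assms by (simp add: mult.commute)

text \<open>
  In \<open>h\<close> this monomial is \<open>h (x - z)\<close> plus a constant, hence monotone or antitone; the formulation with
  powers also covers \<open>x\<close> or \<open>z\<close> equal to \<open>-\<infinity>\<close>.
\<close>

lemma monomial_between:
  fixes x z c :: tropical
  assumes "min h k \<le> j" "j \<le> max h k" "h \<le> l" "k \<le> l"
  defines "f \<equiv> \<lambda>i. c * (x ^ i * z ^ (l - i))"
  shows "min (f h) (f k) \<le> f j \<and> f j \<le> max (f h) (f k)"
proof (cases "x \<le> z")
  case True
  have "f b \<le> f a" if "a \<le> b" "b \<le> l" for a b
    unfolding f_def by (intro mult_left_mono monomial_antimono True that) simp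
  then show ?thesis using assms(1-4)
    by (smt (verit) le_trans max_def min_def nle_le)
next
  case False
  then have "f a \<le> f b" if "a \<le> b" "b \<le> l" for a b
    unfolding f_def by (intro mult_left_mono monomial_mono that) simp_all
  then show ?thesis using assms(1-4)
    by (smt (verit) le_trans max_def min_def nle_le)
qed

section \<open>Words as products of upper triangular matrices\<close>

text \<open>
  The upper right entry of the product, along a word, of the matrices with diagonal \<open>x c\<close>, \<open>z c\<close> and
  upper right entry \<open>y c\<close>.
\<close>

fun corner :: "('a \<Rightarrow> 'b) \<Rightarrow> ('a \<Rightarrow> 'b) \<Rightarrow> ('a \<Rightarrow> 'b) \<Rightarrow> 'a list \<Rightarrow> 'b :: comm_semiring_1" where
  "corner x y z [] = 0"
| "corner x y z (c # w) = x c * corner x y z w + y c * prod_list (map z w)"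

lemma corner_append:
  "corner x y z (w @ v) = prod_list (map x w) * corner x y z v + corner x y z w * prod_list (map z v)"
  by (induction w) (simp_all add: algebra_simps)

lemma sum_upto_2: "(\<Sum>i = 0..<2. f i) = f 0 + f (1 :: nat)"
  by (simp add: numeral_2_eq_2)

lemma UT_2_mult:
  assumes "M \<in> UT 2" "N \<in> UT 2"
  shows "(M * N) $$ (0, 0) = M $$ (0, 0) * N $$ (0, 0)"
    and "(M * N) $$ (0, 1) = M $$ (0, 0) * N $$ (0, 1) + M $$ (0, 1) * N $$ (1, 1)"
    and "(M * N) $$ (1, 1) = M $$ (1, 1) * N $$ (1, 1)"
  using assms
  by (auto simp: UT_def upper_triangular_def scalar_prod_def sum_upto_2)

lemma UT_2_eqI:
  assumes "M \<in> UT 2" "N \<in> UT 2"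
    and "M $$ (0, 0) = N $$ (0, 0)" "M $$ (0, 1) = N $$ (0, 1)" "M $$ (1, 1) = N $$ (1, 1)"
  shows "M = N"
  using assms by (intro eq_matI) (auto simp: UT_def upper_triangular_def less_2_cases_iff)

lemma UT_morphism_entries:
  assumes "UT_morphism 2 \<phi>" "w \<noteq> []"
  defines "x \<equiv> \<lambda>c. \<phi> [c] $$ (0, 0)" and "y \<equiv> \<lambda>c. \<phi> [c] $$ (0, 1)"
    and "z \<equiv> \<lambda>c. \<phi> [c] $$ (1, 1)"
  shows "\<phi> w $$ (0, 0) = prod_list (map x w) \<and> \<phi> w $$ (0, 1) = corner x y z w \<and>
    \<phi> w $$ (1, 1) = prod_list (map z w)"
  using assms(2)
proof (induction w rule: list_nonempty_induct)
  case (cons c w)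
  have "\<phi> (c # w) = \<phi> [c] * \<phi> w" "\<phi> [c] \<in> UT 2" "\<phi> w \<in> UT 2"
    using assms(1) cons.hyps unfolding UT_morphism_def by (metis append_Cons append_Nil list.distinct(1))+
  then show ?case
    unfolding \<open>\<phi> (c # w) = \<phi> [c] * \<phi> w\<close> using cons.IH by (simp only: UT_2_mult) (simp add: x_def y_def z_def)
qed (simp add: x_def y_def z_def)

lemma UT_morphism_exists:
  fixes x y z :: "'a \<Rightarrow> tropical"
  shows "\<exists>\<phi>. UT_morphism 2 \<phi> \<and> (\<forall>w. \<phi> w $$ (0, 1) = corner x y z w)"
proof -
  define \<phi> where "\<phi> w = mat 2 2 (\<lambda>(i, j). if i = 0
    then if j = 0 then prod_list (map x w) else corner x y z w
    else if j = 0 then 0 else prod_list (map z w))" for w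
  have UT: "\<phi> w \<in> UT 2" for w by (auto simp: \<phi>_def UT_def)
  have "\<phi> w * \<phi> v \<in> UT 2" for w v
    by (auto simp: \<phi>_def UT_def less_2_cases_iff scalar_prod_def sum_upto_2)
  then have "\<phi> (w @ v) = \<phi> w * \<phi> v" for w v
    by (intro UT_2_eqI UT) (simp_all only: UT_2_mult[OF UT UT], simp_all add: \<phi>_def corner_append)
  then show ?thesis using UT by (intro exI[of _ \<phi>]) (auto simp: UT_morphism_def \<phi>_def)
qed

text \<open>
  With \<open>UT_equivI\<close> below, this reduces \<open>\<sim>\<^bsub>2\<^esub>\<close> on \<open>W la lb\<close> to the corner entries: the diagonal entries
  depend only on how often each letter occurs.
\<close>

lemma UT_equiv_corner:
  assumes "w \<sim>\<^bsub>2\<^esub> v"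
  shows "corner x y z w = (corner x y z v :: tropical)"
  using UT_morphism_exists[of x y z] assms unfolding UT_equiv_def by metis

lemma prod_list_letters:
  fixes x :: "letter \<Rightarrow> 'b :: comm_semiring_1"
  shows "prod_list (map x w) = x A ^ count_list w A * x B ^ count_list w B"
proof (induction w)
  case (Cons c w)
  then show ?case by (cases c) (simp_all add: algebra_simps)
qed simp

lemma UT_equivI:
  assumes "w \<in> W la lb" "v \<in> W la lb"
    and "\<And>x y z. corner x y z w = (corner x y z v :: tropical)"
  shows "w \<sim>\<^bsub>2\<^esub> v"
proof (cases "w = [] \<or> v = []")
  case True
  then have "la = 0" using assms(1,2) by (auto simp: W_def)
  then have "w = v" by (intro bs_before_inject[OF assms(1,2)]) simp
  then show ?thesis by (simp add: UT_equiv_def)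
next
  case False
  have "\<phi> w = \<phi> v" if "UT_morphism 2 \<phi>" for \<phi>
  proof (rule UT_2_eqI)
    show "\<phi> w \<in> UT 2" "\<phi> v \<in> UT 2" using that False by (auto simp: UT_morphism_def)
    have "count_list w A = count_list v A" "count_list w B = count_list v B"
      using assms(1,2) by (simp_all add: W_def)
    then have prod: "prod_list (map f w) = prod_list (map f v)" for f :: "letter \<Rightarrow> tropical"
      by (simp add: prod_list_letters)
    from False have "w \<noteq> []" "v \<noteq> []" by auto
    from this[THEN UT_morphism_entries[OF that]]
    show "\<phi> w $$ (0, 0) = \<phi> v $$ (0, 0)" "\<phi> w $$ (0, 1) = \<phi> v $$ (0, 1)"
      "\<phi> w $$ (1, 1) = \<phi> v $$ (1, 1)"
      by (simp_all only: prod assms(3))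
  qed
  then show ?thesis by (simp add: UT_equiv_def)
qed

abbreviation indicator_letter :: "letter \<Rightarrow> letter \<Rightarrow> 'b :: comm_semiring_1" where
  "indicator_letter c \<equiv> \<lambda>d. if d = c then 1 else 0"

lemma corner_split:
  "corner x y z w = y A * corner x (indicator_letter A) z w + y B * corner x (indicator_letter B) z w"
proof (induction w)
  case (Cons c w)
  then show ?case by (cases c) (simp_all add: algebra_simps)
qed simp

text \<open>
  The sum has one summand for each occurrence of \<open>A\<close>: the letters before it contribute their \<open>x\<close> and
  the letters after it their \<open>z\<close>.
\<close>

lemma corner_A:
  assumes "w \<in> W la lb"
  shows "corner x (indicator_letter A) z w =
    (\<Sum>i<la. x A ^ i * z A ^ (la - 1 - i) * (x B ^ bs_before i w * z B ^ (lb - bs_before i w)))"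
  using assms
proof (induction w arbitrary: la lb)
  case Nil
  then show ?case by (simp add: W_def)
next
  case (Cons c w)
  show ?case
  proof (cases c)
    case A
    then obtain la' where la: "la = Suc la'" "w \<in> W la' lb"
      using Cons.prems by (auto simp: W_def)
    let ?t = "\<lambda>i. x A ^ i * z A ^ (la - 1 - i) *
      (x B ^ bs_before i (c # w) * z B ^ (lb - bs_before i (c # w)))"
    have "?t 0 = prod_list (map z w)"
      using A la by (simp add: prod_list_letters W_def)
    moreover have "(\<Sum>i<la'. ?t (Suc i)) = x A * corner x (indicator_letter A) z w"
      unfolding Cons.IH[OF la(2)] sum_distrib_left
      using A la(1) by (intro sum.cong) (simp_all add: mult.assoc)
    ultimately have "(\<Sum>i<la. ?t i) = corner x (indicator_letter A) z (c # w)"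
      using A la(1) by (simp add: sum.lessThan_Suc_shift add.commute del: sum.lessThan_Suc)
    then show ?thesis by simp
  next
    case B
    then obtain lb' where lb: "lb = Suc lb'" "w \<in> W la lb'"
      using Cons.prems by (auto simp: W_def)
    have "corner x (indicator_letter A) z (c # w) = x B * corner x (indicator_letter A) z w"
      using B by simp
    also have "\<dots> = (\<Sum>i<la. x A ^ i * z A ^ (la - 1 - i) *
      (x B ^ bs_before i (c # w) * z B ^ (lb - bs_before i (c # w))))"
      unfolding Cons.IH[OF lb(2)] sum_distrib_left
      using B lb(1) by (intro sum.cong) (simp_all add: ac_simps)
    finally show ?thesis .
  qed
qed

section \<open>Exchanging the letters\<close>

fun swap_letter :: "letter \<Rightarrow> letter" where
  "swap_letter A = B"
| "swap_letter B = A"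

lemma swap_letter_swap_letter [simp]: "swap_letter (swap_letter c) = c"
  by (cases c) simp_all

lemma swap_W: "map swap_letter w \<in> W lb la \<longleftrightarrow> w \<in> W la lb"
proof -
  have "count_list (map swap_letter w) (swap_letter d) = count_list w d" for d
    by (induction w) (auto, metis swap_letter_swap_letter)
  from this[of A] this[of B] show ?thesis by (auto simp: W_def)
qed

lemma corner_swap:
  "corner x y z (map swap_letter w) = corner (x \<circ> swap_letter) (y \<circ> swap_letter) (z \<circ> swap_letter) w"
  by (induction w) (simp_all add: comp_def)

text \<open>
  Both sides say that the \<open>(i + 1)\<close>th \<open>A\<close> comes before the \<open>(j + 1)\<close>th \<open>B\<close>. This is the Galois
  connection between the heights of a path and those of its reflection in the diagonal.
\<close>

lemma less_bs_before_swap: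
  assumes "i < count_list w A" "j < count_list w B"
  shows "i < bs_before j (map swap_letter w) \<longleftrightarrow> bs_before i w \<le> j"
  using assms
proof (induction w arbitrary: i j)
  case (Cons c w)
  then show ?case by (cases c; cases i; cases j) auto
qed simp

section \<open>Words between two equivalent words\<close>

definition between :: "nat \<Rightarrow> letter list \<Rightarrow> letter list \<Rightarrow> letter list \<Rightarrow> bool" where
  "between n w v u \<longleftrightarrow> (\<forall>i<n. min (bs_before i w) (bs_before i v) \<le> bs_before i u \<and>
     bs_before i u \<le> max (bs_before i w) (bs_before i v))"

text \<open>
  For a fixed \<open>j\<close>, the indices \<open>i\<close> with \<open>bs_before i s \<le> j\<close> form the initial segment below the
  reflected height of \<open>s\<close>. Being between means that the segment of \<open>u\<close> contains the intersection of
  those of \<open>w\<close> and \<open>v\<close> and is contained in their union, and for initial segments this bounds the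
  lengths by the minimum and the maximum.
\<close>

lemma between_swap:
  assumes "w \<in> W la lb" "v \<in> W la lb" "u \<in> W la lb" "between la w v u"
  shows "between lb (map swap_letter w) (map swap_letter v) (map swap_letter u)"
  unfolding between_def
proof (intro allI impI)
  fix j assume j: "j < lb"
  let ?g = "\<lambda>s. bs_before j (map swap_letter s)"
  have iff: "i < ?g s \<longleftrightarrow> i < la \<and> bs_before i s \<le> j" if "s \<in> W la lb" for i s
  proof -
    have "?g s \<le> la"
      using bs_before_le[of j "map swap_letter s"] swap_W[of s lb la] that by (simp add: W_def)
    then show ?thesis using less_bs_before_swap[of i s j] that j by (auto simp: W_def)
  qed
  have 1: "i < ?g u" if "i < ?g w" "i < ?g v" for i
    using that assms unfolding iff[OF assms(1)] iff[OF assms(2)] iff[OF assms(3)] between_def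
    by fastforce
  have 2: "i < ?g w \<or> i < ?g v" if "i < ?g u" for i
    using that assms unfolding iff[OF assms(1)] iff[OF assms(2)] iff[OF assms(3)] between_def
    by fastforce
  show "min (?g w) (?g v) \<le> ?g u \<and> ?g u \<le> max (?g w) (?g v)"
    using 1[of "?g u"] 2[of "max (?g w) (?g v)"] by linarith
qed

text \<open>
  The sums in \<open>corner_A\<close> are treated as tropical polynomials in a factor \<open>d\<close> of \<open>x A\<close>, which is why the
  assumption quantifies over all \<open>x\<close> with \<open>z\<close> fixed.
\<close>

lemma corner_A_between:
  fixes x z :: "letter \<Rightarrow> tropical"
  assumes W: "w \<in> W la lb" "v \<in> W la lb" "u \<in> W la lb" and b: "between la w v u"
    and eq: "\<And>x. corner x (indicator_letter A) z w = corner x (indicator_letter A) z v"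
  shows "corner x (indicator_letter A) z u = corner x (indicator_letter A) z w"
proof -
  let ?f = "\<lambda>s i. x A ^ i * z A ^ (la - 1 - i) * (x B ^ bs_before i s * z B ^ (lb - bs_before i s))"
  have le: "bs_before i s \<le> lb" if "s \<in> W la lb" for i s
    using bs_before_le[of i s] that by (simp add: W_def)
  have "(\<Sum>i<la. ?f u i) = (\<Sum>i<la. ?f w i)"
  proof (rule sum_between)
    fix d
    have scaled: "corner (x(A := d * x A)) (indicator_letter A) z s = (\<Sum>i<la. d ^ i * ?f s i)"
      if "s \<in> W la lb" for s
      by (subst corner_A[OF that]) (simp add: power_mult_distrib mult.assoc)
    show "(\<Sum>i<la. d ^ i * ?f w i) = (\<Sum>i<la. d ^ i * ?f v i)"
      using eq[of "x(A := d * x A)"] by (simp only: scaled W)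
  next
    fix i assume "i < la"
    then show "min (?f w i) (?f v i) \<le> ?f u i \<and> ?f u i \<le> max (?f w i) (?f v i)"
      using b by (intro monomial_between le W) (auto simp: between_def)
  qed
  then show ?thesis by (simp only: corner_A[OF W(1)] corner_A[OF W(3)])
qed

lemma UT_equiv_between:
  assumes W: "w \<in> W la lb" "v \<in> W la lb" "u \<in> W la lb" and b: "between la w v u"
    and eq: "w \<sim>\<^bsub>2\<^esub> v"
  shows "w \<sim>\<^bsub>2\<^esub> u"
proof (rule UT_equivI[OF W(1,3)])
  fix x y z :: "letter \<Rightarrow> tropical"
  have A: "corner x (indicator_letter A) z u = corner x (indicator_letter A) z w"
    by (rule corner_A_between[OF W b]) (rule UT_equiv_corner[OF eq])
  have "corner (x \<circ> swap_letter) (indicator_letter A) (z \<circ> swap_letter) (map swap_letter u) =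
    corner (x \<circ> swap_letter) (indicator_letter A) (z \<circ> swap_letter) (map swap_letter w)"
    by (rule corner_A_between[OF W[THEN iffD2[OF swap_W]] between_swap[OF W b]])
      (unfold corner_swap, rule UT_equiv_corner[OF eq])
  moreover have "indicator_letter A \<circ> swap_letter = (indicator_letter B :: letter \<Rightarrow> tropical)"
  proof
    show "(indicator_letter A \<circ> swap_letter) c = indicator_letter B c" for c
      by (cases c) simp_all
  qed
  moreover have "f \<circ> swap_letter \<circ> swap_letter = f" for f :: "letter \<Rightarrow> tropical"
    by (simp add: fun_eq_iff)
  ultimately have B: "corner x (indicator_letter B) z u = corner x (indicator_letter B) z w"
    by (simp only: corner_swap)
  show "corner x y z w = corner x y z u"
    by (simp only: corner_split[of x y z w] corner_split[of x y z u] A B)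
qed

lemma UT_equiv_sym: "w \<sim>\<^bsub>n\<^esub> v \<Longrightarrow> v \<sim>\<^bsub>n\<^esub> w"
  unfolding UT_equiv_def by metis

lemma UT_equiv_trans: "w \<sim>\<^bsub>n\<^esub> v \<Longrightarrow> v \<sim>\<^bsub>n\<^esub> u \<Longrightarrow> w \<sim>\<^bsub>n\<^esub> u"
  unfolding UT_equiv_def by metis

section \<open>Joins and meets\<close>

lemma word_order_simps:
  "carrier (word_order la lb) = W la lb"
  "s \<in> W la lb \<Longrightarrow> s \<sqsubseteq>\<^bsub>word_order la lb\<^esub> t \<longleftrightarrow> (\<forall>i < la. bs_before i s \<le> bs_before i t)"
  by (auto simp: word_order_def path_le_def W_def)

text \<open>
  The join lies below the word whose heights are the pointwise maxima, and above \<open>w\<close>; this is all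
  that \<open>between\<close> requires.
\<close>

lemma join_between:
  assumes "w \<in> W la lb" "v \<in> W la lb"
  shows "w \<squnion>\<^bsub>word_order la lb\<^esub> v \<in> W la lb" "between la w v (w \<squnion>\<^bsub>word_order la lb\<^esub> v)"
proof -
  interpret lattice "word_order la lb" by (rule lattice_word_order)
  let ?j = "w \<squnion>\<^bsub>word_order la lb\<^esub> v"
  show j: "?j \<in> W la lb" using join_closed[of w v] assms by (simp add: word_order_simps)
  have "\<exists>s \<in> W la lb. \<forall>i < la. bs_before i s = max (bs_before i w) (bs_before i v)"
  proof (rule exists_word_bs_before)
    show "max (bs_before i w) (bs_before i v) \<le> max (bs_before j w) (bs_before j v)"
      if "i \<le> j" "j < la" for i j
      using that assms by (intro max.mono bs_before_mono) (auto simp: W_def)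
    show "max (bs_before i w) (bs_before i v) \<le> lb" for i
      using assms bs_before_le[of i w] bs_before_le[of i v] by (simp add: W_def)
  qed
  then obtain s where s: "s \<in> W la lb" "\<And>i. i < la \<Longrightarrow> bs_before i s = max (bs_before i w) (bs_before i v)"
    by blast
  have "?j \<sqsubseteq>\<^bsub>word_order la lb\<^esub> s"
    using s assms by (intro join_le) (simp_all add: word_order_simps)
  moreover have "w \<sqsubseteq>\<^bsub>word_order la lb\<^esub> ?j"
    using assms by (intro join_left) (simp_all add: word_order_simps)
  ultimately show "between la w v ?j"
    using s(2) assms j by (auto simp: word_order_simps between_def min_le_iff_disj)
qed

lemma meet_between:
  assumes "w \<in> W la lb" "v \<in> W la lb"
  shows "w \<sqinter>\<^bsub>word_order la lb\<^esub> v \<in> W la lb" "between la w v (w \<sqinter>\<^bsub>word_order la lb\<^esub> v)"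
proof -
  interpret lattice "word_order la lb" by (rule lattice_word_order)
  let ?m = "w \<sqinter>\<^bsub>word_order la lb\<^esub> v"
  show m: "?m \<in> W la lb" using meet_closed[of w v] assms by (simp add: word_order_simps)
  have "\<exists>s \<in> W la lb. \<forall>i < la. bs_before i s = min (bs_before i w) (bs_before i v)"
  proof (rule exists_word_bs_before)
    show "min (bs_before i w) (bs_before i v) \<le> min (bs_before j w) (bs_before j v)"
      if "i \<le> j" "j < la" for i j
      using that assms by (intro min.mono bs_before_mono) (auto simp: W_def)
    show "min (bs_before i w) (bs_before i v) \<le> lb" for i
      using assms bs_before_le[of i w] by (simp add: W_def min_le_iff_disj)
  qed
  then obtain s where s: "s \<in> W la lb" "\<And>i. i < la \<Longrightarrow> bs_before i s = min (bs_before i w) (bs_before i v)"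
    by blast
  have "s \<sqsubseteq>\<^bsub>word_order la lb\<^esub> ?m"
    using s assms by (intro meet_le) (simp_all add: word_order_simps)
  moreover have "?m \<sqsubseteq>\<^bsub>word_order la lb\<^esub> w"
    using assms by (intro meet_left) (simp_all add: word_order_simps)
  ultimately show "between la w v ?m"
    using s assms m by (auto simp: word_order_simps between_def le_max_iff_disj)
qed

theorem theorem1p1:
  fixes la lb :: nat and w u v :: "letter list"
  assumes "w \<in> W la lb" and "u \<in> W la lb" and "v \<in> W la lb"
  shows "(w \<preceq> u \<and> u \<preceq> v \<and> w \<sim>\<^bsub>2\<^esub> v \<longrightarrow> w \<sim>\<^bsub>2\<^esub> u) \<and>
         (w \<sim>\<^bsub>2\<^esub> v \<longrightarrow>
            w \<sim>\<^bsub>2\<^esub> (w \<squnion>\<^bsub>word_order la lb\<^esub> v) \<and>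
            (w \<squnion>\<^bsub>word_order la lb\<^esub> v) \<sim>\<^bsub>2\<^esub> (w \<sqinter>\<^bsub>word_order la lb\<^esub> v))"
proof (intro conjI impI; (elim conjE)?)
  assume "w \<preceq> u" "u \<preceq> v" and eq: "w \<sim>\<^bsub>2\<^esub> v"
  then have "between la w v u"
    using assms by (auto simp: path_le_def between_def W_def min_le_iff_disj le_max_iff_disj)
  then show "w \<sim>\<^bsub>2\<^esub> u" using UT_equiv_between assms eq by blast
next
  assume eq: "w \<sim>\<^bsub>2\<^esub> v"
  show join: "w \<sim>\<^bsub>2\<^esub> (w \<squnion>\<^bsub>word_order la lb\<^esub> v)"
    by (rule UT_equiv_between[OF assms(1,3) join_between[OF assms(1,3)] eq])
  have "w \<sim>\<^bsub>2\<^esub> (w \<sqinter>\<^bsub>word_order la lb\<^esub> v)"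
    by (rule UT_equiv_between[OF assms(1,3) meet_between[OF assms(1,3)] eq])
  then show "(w \<squnion>\<^bsub>word_order la lb\<^esub> v) \<sim>\<^bsub>2\<^esub> (w \<sqinter>\<^bsub>word_order la lb\<^esub> v)"
    using join UT_equiv_sym UT_equiv_trans by blast
qed

end
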